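(* Let $$\Phi(t)=P_0\left[e^{(g-m-\rho)t}\left(e^{rt}+1\right)-2e^{\left(\frac12 g-\frac18\sigma^2-\frac12 m-\rho\right)t}\right],\qquad t\ge 0.$$ There exists a function $\phi_t$, $t\ge 0$, that attains the lower bound $\Phi$ on discounted cumulative fees, i.e. such that $\int_0^t\phi_se^{-\rho s}\,ds=\Phi(t)$. This function is given explicitly by (i) for reward-bearing liquid staking tokens, where $g>0$ and $r=0$: $$\phi_t=P_0\left[2(g-m-\rho)e^{(g-m-\rho)t}-\left(g-\tfrac14\sigma^2-m-2\rho\right)e^{\left(\frac12 g-\frac18\sigma^2-\frac12 m-\rho\right)t}\right];$$ (ii) for rebasing liquid staking tokens, where $g=0$ and $r>0$: $$\phi_t=P_0\left[(r-m-\rho)e^{(r-m-\rho)t}-(m+\rho)e^{(-m-\rho)t}+\left(\tfrac14\sigma^2+m+2\rho\right)e^{\left(-\frac18\sigma^2-\frac12 m-\rho\right)t}\right].$$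
   Context: The price $P_t$ of a liquid staking token (LST) in ETH follows the geometric Brownian motion $dP_t/P_t=g\,dt+\sigma\,dB_t$ with initial price $P_0$, drift $g\ge 0$, volatility $\sigma>0$ and $B$ a standard Brownian motion. $m>0$ is the parameter of the exit discount factor $e^{-mt}$, $r$ is the staking reward rate, and $\rho$ is the investor's discount rate. Reward-bearing tokens have $P_0>1$, $g>0$, $r=0$; rebasing tokens have $P_0=1$, $g=0$, $r>0$. Throughout it is assumed that $r+g-\rho-m>\ln P_0>0$ (as printed). $\phi_t$ is the rate of transaction fees earned per unit of LST deposited in an automated market maker (AMM), so $\int_0^t\phi_se^{-\rho s}\,ds$ is the discounted cumulative fee per unit of LST up to time $t$. $\Phi(t)$ is the lower bound on this quantity: an investor exiting at time $t$ finds it optimal to provide liquidity (depositing $\frac{1}{2P_0}$ LST and $\frac12$ ETH out of an initial 1 ETH) if and only if $\int_0^t\phi_se^{-\rho s}\,ds>\Phi(t)$. "Attaining the bound" means $\int_0^t\phi_se^{-\rho s}\,ds=\Phi(t)$.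
   Formalization: The printed formulas for φ_t equal Φ'(t) and fail to attain Φ when ρ≠0 (unless Φ'≡0); the formal statement multiplies both by e^{ρt}. The assumption ln P_0>0, contradictory for rebasing tokens with P_0=1, is relaxed to ln P_0≥0. *)

theory Defs
  imports "HOL-Analysis.Analysis"
begin

definition reward_bearing :: "real \<Rightarrow> real \<Rightarrow> real \<Rightarrow> bool" where
  "reward_bearing P0 g r \<longleftrightarrow> P0 > 1 \<and> g > 0 \<and> r = 0"

definition rebasing :: "real \<Rightarrow> real \<Rightarrow> real \<Rightarrow> bool" where
  "rebasing P0 g r \<longleftrightarrow> P0 = 1 \<and> g = 0 \<and> r > 0"

definition fee_bound :: "real \<Rightarrow> real \<Rightarrow> real \<Rightarrow> real \<Rightarrow> real \<Rightarrow> real \<Rightarrow> real \<Rightarrow> real" where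
  "fee_bound P0 g \<sigma> m r \<rho> t =
     P0 * (exp ((g - m - \<rho>) * t) * (exp (r * t) + 1)
           - 2 * exp ((1/2 * g - 1/8 * \<sigma>\<^sup>2 - 1/2 * m - \<rho>) * t))"

text \<open>The integral of the discounted fees is required to exist, not only to have the value \<open>\<Phi> t\<close>.\<close>

definition attains_bound :: "(real \<Rightarrow> real) \<Rightarrow> real \<Rightarrow> (real \<Rightarrow> real) \<Rightarrow> bool" where
  "attains_bound \<phi> \<rho> \<Phi> \<longleftrightarrow>
     (\<forall>t\<ge>0. ((\<lambda>s. \<phi> s * exp (- \<rho> * s)) has_integral \<Phi> t) {0..t})"

text \<open>
  The next two definitions are the closed formulas that the source prints for the fee rate
  \<open>\<phi>\<close> itself.  They equal the derivative of the bound \<open>\<Phi>\<close>, whereas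
  \<open>\<integral>\<^sub>0\<^sup>t \<phi> s exp (- \<rho> s) ds = \<Phi> t\<close> forces
  \<open>\<phi> t exp (- \<rho> t) = \<Phi>' t\<close>.  So the printed formulas are those of the discounted fee
  rate \<open>\<phi> t exp (- \<rho> t)\<close>; the fee rate is \<open>exp (\<rho> t)\<close> times them.
  The lemma \<open>printed_formula_does_not_attain\<close> shows that this factor cannot be omitted.
\<close>

definition discounted_fee_rate_reward ::
    "real \<Rightarrow> real \<Rightarrow> real \<Rightarrow> real \<Rightarrow> real \<Rightarrow> real \<Rightarrow> real" where
  "discounted_fee_rate_reward P0 g \<sigma> m \<rho> t =
     P0 * (2 * (g - m - \<rho>) * exp ((g - m - \<rho>) * t)
           - (g - 1/4 * \<sigma>\<^sup>2 - m - 2 * \<rho>)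
             * exp ((1/2 * g - 1/8 * \<sigma>\<^sup>2 - 1/2 * m - \<rho>) * t))"

definition discounted_fee_rate_rebasing ::
    "real \<Rightarrow> real \<Rightarrow> real \<Rightarrow> real \<Rightarrow> real \<Rightarrow> real \<Rightarrow> real" where
  "discounted_fee_rate_rebasing P0 \<sigma> m r \<rho> t =
     P0 * ((r - m - \<rho>) * exp ((r - m - \<rho>) * t)
           - (m + \<rho>) * exp ((- m - \<rho>) * t)
           + (1/4 * \<sigma>\<^sup>2 + m + 2 * \<rho>)
             * exp ((- (1/8) * \<sigma>\<^sup>2 - 1/2 * m - \<rho>) * t))"

lemma printed_formula_does_not_attain:
  fixes P0 g \<sigma> m r \<rho> :: real
  assumes "reward_bearing P0 g r" "r + g - \<rho> - m > ln P0" "\<rho> > 0"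
  shows "\<not> attains_bound (discounted_fee_rate_reward P0 g \<sigma> m \<rho>) \<rho> (fee_bound P0 g \<sigma> m r \<rho>)"
proof
  let ?f = "discounted_fee_rate_reward P0 g \<sigma> m \<rho>"
  let ?F = "fee_bound P0 g \<sigma> m r \<rho>"
  assume att: "attains_bound ?f \<rho> ?F"
  have P: "P0 > 1" and r: "r = 0" using assms by (auto simp: reward_bearing_def)
  have gm: "g - m > \<rho>" using assms(2) r ln_gt_zero[OF P] by linarith
  have der: "(?F has_real_derivative ?f x) (at x)" for x
    unfolding fee_bound_def [abs_def] discounted_fee_rate_reward_def r
    by (rule derivative_eq_intros refl | simp)+ (simp add: algebra_simps)
  have F0: "?F 0 = 0" by (simp add: fee_bound_def)
  have int2: "(?f has_integral ?F t) {0..t}" if "t \<ge> 0" for t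
    using fundamental_theorem_of_calculus[of 0 t ?F ?f] der that F0
    by (auto simp: has_real_derivative_iff_has_vector_derivative
             intro: has_vector_derivative_at_within)
  let ?d = "\<lambda>s. ?f s * (1 - exp (- \<rho> * s))"
  have int: "(?d has_integral 0) {0..t}" if "t \<ge> 0" for t
  proof -
    have "((\<lambda>s. ?f s - ?f s * exp (- \<rho> * s)) has_integral (?F t - ?F t)) {0..t}"
      using int2[OF that] att that unfolding attains_bound_def
      by (intro has_integral_diff) auto
    then show ?thesis by (simp add: algebra_simps)
  qed
  have cont: "continuous_on A ?f" for A
    unfolding discounted_fee_rate_reward_def by (intro continuous_intros)
  have "?f 0 = P0 * (g - m + \<sigma>\<^sup>2 / 4)"
    by (simp add: discounted_fee_rate_reward_def algebra_simps)
  moreover have "g - m + \<sigma>\<^sup>2 / 4 > 0" using gm assms(3) zero_le_power2[of \<sigma>] by linarith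
  ultimately have "?f 0 > 0" using P by simp
  then have "eventually (\<lambda>x. ?f x > 0) (at 0)"
    using cont[of UNIV] order_tendstoD(1)[of ?f "?f 0" "at 0" 0] by (auto simp: continuous_on_def)
  then obtain e where e: "e > 0" "\<And>x. x \<noteq> 0 \<Longrightarrow> dist x 0 < e \<Longrightarrow> ?f x > 0"
    unfolding eventually_at by auto
  define t where "t = e / 2"
  have t: "t > 0" "t < e" using e by (auto simp: t_def)
  have pos: "?d x > 0" if "0 < x" "x \<le> t" for x
    using that e(2)[of x] t assms(3) by simp
  have nn: "?d x \<ge> 0" if "x \<in> {0..t}" for x
    using that pos[of x] by (cases "x = 0") auto
  have "?d t = 0"
  proof (rule has_integral_0_cbox_imp_0[of 0 t ?d])
    show "continuous_on (cbox 0 t) ?d" using cont by (intro continuous_intros) auto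
    show "0 \<le> ?d x" if "x \<in> box 0 t" for x using nn that by simp
    show "(?d has_integral 0) (cbox 0 t)" using int[of t] t by simp
    show "t \<in> cbox 0 t" using t by simp
    show "box 0 t \<noteq> {}" using t by simp
  qed
  then show False using pos[of t] t by linarith
qed

end

theory Submission imports Defs begin

text \<open>The bound \<Phi> is smooth and vanishes at 0, so the fundamental theorem of calculus
  writes \<Phi>(t) as the integral of its derivative over [0,t]. A fee rate of exp(\<rho> t) times
  that derivative undoes the discounting and hence attains the bound
  (\<open>attains_bound_of_derivative\<close>). One witness, built from
  \<open>fee_bound_deriv\<close>, serves all parameters; the two closed formulas are its
  specialisations to r = 0 and to g = 0.\<close>

definition fee_bound_deriv :: "real \<Rightarrow> real \<Rightarrow> real \<Rightarrow> real \<Rightarrow> real \<Rightarrow> real \<Rightarrow> real \<Rightarrow> real" where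
  "fee_bound_deriv P0 g \<sigma> m r \<rho> t =
     P0 * ((g - m - \<rho>) * exp ((g - m - \<rho>) * t) * (exp (r * t) + 1)
           + exp ((g - m - \<rho>) * t) * (r * exp (r * t))
           - (g - 1/4 * \<sigma>\<^sup>2 - m - 2 * \<rho>)
             * exp ((1/2 * g - 1/8 * \<sigma>\<^sup>2 - 1/2 * m - \<rho>) * t))"

text \<open>Product rule on the first summand; in the second, the factor 2 doubles the rate in the
  exponent, which gives the coefficient g - \<sigma>^2/4 - m - 2\<rho>.\<close>

lemma fee_bound_has_derivative:
  "(fee_bound P0 g \<sigma> m r \<rho> has_real_derivative fee_bound_deriv P0 g \<sigma> m r \<rho> t) (at t)"
  unfolding fee_bound_def [abs_def] fee_bound_deriv_def
  by (rule derivative_eq_intros refl | simp)+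

lemma fee_bound_deriv_reward:
  "fee_bound_deriv P0 g \<sigma> m 0 \<rho> t = discounted_fee_rate_reward P0 g \<sigma> m \<rho> t"
  by (simp add: fee_bound_deriv_def discounted_fee_rate_reward_def algebra_simps)

lemma fee_bound_deriv_rebasing:
  "fee_bound_deriv P0 0 \<sigma> m r \<rho> t = discounted_fee_rate_rebasing P0 \<sigma> m r \<rho> t"
proof -
  \<comment> \<open>Splitting this exponential lets the product-rule terms with coefficients
    -m-\<rho> and r merge into the single coefficient r-m-\<rho>.\<close>
  have "exp ((r - m - \<rho>) * t) = exp ((- m - \<rho>) * t) * exp (r * t)"
    by (simp add: algebra_simps flip: exp_add)
  then show ?thesis
    by (simp add: fee_bound_deriv_def discounted_fee_rate_rebasing_def algebra_simps)
qed

text \<open>The zero initial value matters: the fundamental theorem yields \<Phi>(t) - \<Phi>(0),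
  and it also supplies existence of the integral.\<close>

lemma attains_bound_of_derivative:
  assumes der: "\<And>t. (\<Phi> has_real_derivative \<Phi>' t) (at t)" and zero: "\<Phi> 0 = 0"
  shows "attains_bound (\<lambda>t. exp (\<rho> * t) * \<Phi>' t) \<rho> \<Phi>"
  unfolding attains_bound_def
proof (intro allI impI)
  fix t :: real
  assume "t \<ge> 0"
  then have "(\<Phi>' has_integral \<Phi> t) {0..t}"
    using fundamental_theorem_of_calculus[of 0 t \<Phi> \<Phi>'] der zero
    by (auto simp: has_real_derivative_iff_has_vector_derivative
             intro: has_vector_derivative_at_within)
  moreover have "exp (\<rho> * s) * \<Phi>' s * exp (- \<rho> * s) = \<Phi>' s" for s
    by (simp add: exp_minus field_simps)
  ultimately show "((\<lambda>s. exp (\<rho> * s) * \<Phi>' s * exp (- \<rho> * s)) has_integral \<Phi> t) {0..t}"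
    by presburger
qed

theorem proposition3p13:
  fixes P0 g \<sigma> m r \<rho> :: real
  assumes "P0 > 0" and "g \<ge> 0" and "\<sigma> > 0" and "m > 0"
    and "r + g - \<rho> - m > ln P0" and "ln P0 \<ge> 0"
  shows "\<exists>\<phi>. attains_bound \<phi> \<rho> (fee_bound P0 g \<sigma> m r \<rho>)
     \<and> (reward_bearing P0 g r \<longrightarrow>
          (\<forall>t\<ge>0. \<phi> t = exp (\<rho> * t) * discounted_fee_rate_reward P0 g \<sigma> m \<rho> t))
     \<and> (rebasing P0 g r \<longrightarrow>
          (\<forall>t\<ge>0. \<phi> t = exp (\<rho> * t) * discounted_fee_rate_rebasing P0 \<sigma> m r \<rho> t))"
proof (intro exI conjI)
  show "attains_bound (\<lambda>t. exp (\<rho> * t) * fee_bound_deriv P0 g \<sigma> m r \<rho> t) \<rho>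
          (fee_bound P0 g \<sigma> m r \<rho>)"
    \<comment> \<open>At t = 0 all exponentials are 1, so the bracket in \<Phi> is 1 * (1 + 1) - 2 =
      0.\<close>
    by (intro attains_bound_of_derivative fee_bound_has_derivative) (simp add: fee_bound_def)
qed (auto simp: reward_bearing_def rebasing_def fee_bound_deriv_reward fee_bound_deriv_rebasing)

end
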